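(* Let $n$ be a positive integer and $B_n$ the Boolean lattice of subsets of $\{1,2,\dots,n\}$ ordered by inclusion. Then $\chi_D(B_n)\le n+3$.
   Context: For a finite poset $P$, a coloring is proper if comparable points get different colors and distinguishing if the only color-preserving automorphism of $P$ is the identity; $\chi_D(P)$ is the least number of colors in a proper distinguishing coloring of $P$. *)

theory Defs
  imports Main
begin

text \<open>A poset is a carrier \<^term>\<open>A\<close> with a relation \<^term>\<open>r\<close> such that
  \<^term>\<open>partial_order_on A r\<close>. Automorphisms are functions on the whole type, and only
  their restriction to \<^term>\<open>A\<close> matters.\<close>

definition poset_automorphism :: "'a set \<Rightarrow> 'a rel \<Rightarrow> ('a \<Rightarrow> 'a) \<Rightarrow> bool" where
  "poset_automorphism A r f \<longleftrightarrow>
     bij_betw f A A \<and> (\<forall>x\<in>A. \<forall>y\<in>A. (x, y) \<in> r \<longleftrightarrow> (f x, f y) \<in> r)"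

definition proper_coloring :: "'a set \<Rightarrow> 'a rel \<Rightarrow> ('a \<Rightarrow> 'c) \<Rightarrow> bool" where
  "proper_coloring A r c \<longleftrightarrow>
     (\<forall>x\<in>A. \<forall>y\<in>A. x \<noteq> y \<and> ((x, y) \<in> r \<or> (y, x) \<in> r) \<longrightarrow> c x \<noteq> c y)"

definition distinguishing_coloring :: "'a set \<Rightarrow> 'a rel \<Rightarrow> ('a \<Rightarrow> 'c) \<Rightarrow> bool" where
  "distinguishing_coloring A r c \<longleftrightarrow>
     (\<forall>f. poset_automorphism A r f \<and> (\<forall>x\<in>A. c (f x) = c x) \<longrightarrow> (\<forall>x\<in>A. f x = x))"

definition proper_distinguishing_colorable :: "'a set \<Rightarrow> 'a rel \<Rightarrow> nat \<Rightarrow> bool" where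
  "proper_distinguishing_colorable A r k \<longleftrightarrow>
     (\<exists>c :: 'a \<Rightarrow> nat. c ` A \<subseteq> {..<k} \<and> proper_coloring A r c \<and> distinguishing_coloring A r c)"

definition distinguishing_chromatic_number :: "'a set \<Rightarrow> 'a rel \<Rightarrow> nat" where
  "distinguishing_chromatic_number A r = (LEAST k. proper_distinguishing_colorable A r k)"

definition boolean_lattice_carrier :: "nat \<Rightarrow> nat set set" where
  "boolean_lattice_carrier n = Pow {1..n}"

definition boolean_lattice_order :: "nat \<Rightarrow> nat set rel" where
  "boolean_lattice_order n = {(S, T). S \<subseteq> T \<and> T \<subseteq> {1..n}}"

lemma partial_order_boolean_lattice:
  "partial_order_on (boolean_lattice_carrier n) (boolean_lattice_order n)"
  unfolding boolean_lattice_carrier_def boolean_lattice_order_def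
    partial_order_on_def preorder_on_def refl_on_def trans_def antisym_def
  by auto

text \<open>For a finite poset the minimum is taken over a nonempty set: color the points injectively.\<close>

lemma finite_proper_distinguishing_colorable:
  assumes "finite A"
  shows "proper_distinguishing_colorable A r (card A)"
proof -
  obtain c :: "'a \<Rightarrow> nat" where c: "bij_betw c A {0..<card A}"
    using ex_bij_betw_finite_nat[OF assms] by blast
  then have inj: "inj_on c A" and img: "c ` A = {0..<card A}"
    by (auto simp: bij_betw_def)
  have "proper_coloring A r c"
    using inj by (auto simp: proper_coloring_def inj_on_def)
  moreover have "distinguishing_coloring A r c"
    unfolding distinguishing_coloring_def poset_automorphism_def
    by (metis inj bij_betwE inj_onD)
  ultimately show ?thesis
    unfolding proper_distinguishing_colorable_def
    using img by (intro exI[of _ c]) auto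
qed

lemma distinguishing_chromatic_number_colorable:
  assumes "finite A"
  shows "proper_distinguishing_colorable A r (distinguishing_chromatic_number A r)"
  unfolding distinguishing_chromatic_number_def
  by (rule LeastI) (rule finite_proper_distinguishing_colorable[OF assms])

end

theory Submission
  imports Defs
begin

text \<open>Color every set by its size, except that \<open>{1}\<close> gets one new color and the consecutive pairs
  \<open>{i, i + 1}\<close> get another. Each color class consists of sets of one size, hence is an antichain, so
  the coloring is proper. An automorphism of a power set is induced by a permutation of the
  points; if it preserves colors, the permutation is an automorphism of the path
  \<open>1, 2, \<dots>, n\<close> that fixes the endpoint \<open>1\<close>, and the only such automorphism is the identity.\<close>

lemma distinguishing_chromatic_number_le:
  fixes c :: "'a \<Rightarrow> nat"
  assumes "c ` A \<subseteq> {..<k}" "proper_coloring A r c" "distinguishing_coloring A r c"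
  shows "distinguishing_chromatic_number A r \<le> k"
  unfolding distinguishing_chromatic_number_def
  by (rule Least_le) (use assms in \<open>auto simp: proper_distinguishing_colorable_def\<close>)

lemma proper_coloring_if_color_determines_card:
  assumes "\<And>S. S \<in> A \<Longrightarrow> finite S"
    and "\<And>S T. (S, T) \<in> r \<Longrightarrow> S \<subseteq> T"
    and "\<And>S T. S \<in> A \<Longrightarrow> T \<in> A \<Longrightarrow> c S = c T \<Longrightarrow> card S = card T"
  shows "proper_coloring A r c"
proof -
  have "S = T" if "S \<in> A" "T \<in> A" "(S, T) \<in> r" "c S = c T" for S T
    using card_subset_eq[of T S] assms(1)[of T] assms(2)[of S T] assms(3)[of S T] that by blast
  then show ?thesis
    unfolding proper_coloring_def by metis
qed

locale Pow_automorphism =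
  fixes X :: "'a set" and f :: "'a set \<Rightarrow> 'a set"
  assumes image_Pow: "f ` Pow X = Pow X"
    and image_subset_iff: "S \<subseteq> X \<Longrightarrow> T \<subseteq> X \<Longrightarrow> f S \<subseteq> f T \<longleftrightarrow> S \<subseteq> T"
begin

lemma image_closed: "S \<subseteq> X \<Longrightarrow> f S \<subseteq> X"
  using image_Pow by blast

lemma preimage:
  assumes "T \<subseteq> X"
  obtains S where "S \<subseteq> X" "f S = T"
  using assms image_Pow by (metis PowD PowI imageE)

lemma image_empty [simp]: "f {} = {}"
proof -
  obtain S where "S \<subseteq> X" "f S = {}"
    using preimage[of "{}"] by blast
  then show ?thesis
    using image_subset_iff[of "{}" S] by simp
qed

lemma image_eq_empty_iff: "S \<subseteq> X \<Longrightarrow> f S = {} \<longleftrightarrow> S = {}"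
  using image_subset_iff[of S "{}"] by simp

lemma singleton_preimage:
  assumes "y \<in> X"
  obtains x where "x \<in> X" "f {x} = {y}"
proof -
  obtain S where S: "S \<subseteq> X" "f S = {y}"
    using preimage[of "{y}"] assms by blast
  then obtain x where x: "x \<in> S"
    using image_eq_empty_iff[of S] by blast
  have "f {x} \<subseteq> {y}" "f {x} \<noteq> {}"
    using image_subset_iff[of "{x}" S] image_eq_empty_iff[of "{x}"] S x by auto
  then show thesis
    using that S x by blast
qed

lemma singleton_image:
  assumes "x \<in> X"
  shows "\<exists>y\<in>X. f {x} = {y}"
proof -
  obtain y where y: "y \<in> f {x}" "y \<in> X"
    using image_eq_empty_iff[of "{x}"] image_closed[of "{x}"] assms by blast
  obtain x' where x': "x' \<in> X" "f {x'} = {y}"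
    using singleton_preimage[OF y(2)] .
  then have "x' = x"
    using image_subset_iff[of "{x'}" "{x}"] y assms by simp
  then show ?thesis
    using x' y by blast
qed

lemma induced_by_permutation:
  obtains \<sigma> where "bij_betw \<sigma> X X" "\<And>S. S \<subseteq> X \<Longrightarrow> f S = \<sigma> ` S"
proof -
  obtain \<sigma> where \<sigma>: "\<sigma> x \<in> X" "f {x} = {\<sigma> x}" if "x \<in> X" for x
    using singleton_image by metis
  have "inj_on \<sigma> X"
  proof (rule inj_onI)
    fix x y
    assume "x \<in> X" "y \<in> X" "\<sigma> x = \<sigma> y"
    then show "x = y"
      using image_subset_iff[of "{x}" "{y}"] \<sigma> by simp
  qed
  moreover have surj: "\<exists>x\<in>X. y = \<sigma> x" if "y \<in> X" for y
    using singleton_preimage[OF that] \<sigma>(2) by (metis singleton_inject)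
  ultimately have "bij_betw \<sigma> X X"
    using \<sigma>(1) by (auto simp: bij_betw_def)
  moreover have "f S = \<sigma> ` S" if S: "S \<subseteq> X" for S
  proof -
    have "\<sigma> x \<in> f S \<longleftrightarrow> x \<in> S" if "x \<in> X" for x
      using image_subset_iff[of "{x}" S] \<sigma>(2) S that by simp
    then show ?thesis
      using image_closed[OF S] surj S by blast
  qed
  ultimately show thesis
    using that by blast
qed

end

lemma boolean_lattice_automorphism_imp_Pow_automorphism:
  assumes "poset_automorphism (boolean_lattice_carrier n) (boolean_lattice_order n) f"
  shows "Pow_automorphism {1..n} f"
proof
  show image: "f ` Pow {1..n} = Pow {1..n}"
    using assms by (simp add: poset_automorphism_def boolean_lattice_carrier_def bij_betw_def)
  fix S T :: "nat set"
  assume "S \<subseteq> {1..n}" "T \<subseteq> {1..n}"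
  moreover from this have "f T \<subseteq> {1..n}"
    using image by blast
  ultimately show "f S \<subseteq> f T \<longleftrightarrow> S \<subseteq> T"
    using assms
    by (simp add: poset_automorphism_def boolean_lattice_carrier_def boolean_lattice_order_def)
qed

definition path_edges :: "nat set set" where
  "path_edges = range (\<lambda>i. {i, Suc i})"

lemma doubleton_in_path_edges_iff: "{i, j} \<in> path_edges \<longleftrightarrow> j = Suc i \<or> i = Suc j"
  by (auto simp: path_edges_def doubleton_eq_iff)

lemma card_path_edge: "e \<in> path_edges \<Longrightarrow> card e = 2"
  by (auto simp: path_edges_def)

lemma path_automorphism_fixing_endpoint:
  fixes \<sigma> :: "nat \<Rightarrow> nat"
  assumes inj: "inj_on \<sigma> {a..b}"
    and lower: "\<And>i. i \<in> {a..b} \<Longrightarrow> a \<le> \<sigma> i"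
    and endpoint: "\<sigma> a = a"
    and edge: "\<And>i. i \<in> {a..<b} \<Longrightarrow> {\<sigma> i, \<sigma> (Suc i)} \<in> path_edges"
    and "k \<in> {a..b}"
  shows "\<sigma> k = k"
  using \<open>k \<in> {a..b}\<close>
proof (induction k rule: less_induct)
  case (less k)
  show ?case
  proof (cases "k = a")
    case True
    then show ?thesis
      using endpoint by simp
  next
    case False
    then obtain i where k: "k = Suc i" and i: "i \<in> {a..<b}"
      using less.prems by (cases k) auto
    have "\<sigma> i = i"
      using less.IH k i by simp
    then consider (forward) "\<sigma> k = Suc i" | (backward) "i = Suc (\<sigma> k)"
      using edge[OF i] k by (auto simp: doubleton_in_path_edges_iff)
    then show ?thesis
    proof cases
      case forward
      then show ?thesis
        using k by simp
    next
      case backward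
      then have earlier: "\<sigma> k < k" "\<sigma> k \<in> {a..b}"
        using lower[OF less.prems] k i by auto
      then have "\<sigma> (\<sigma> k) = \<sigma> k"
        by (rule less.IH)
      then show ?thesis
        using inj_onD[OF inj] earlier less.prems by blast
    qed
  qed
qed

definition path_coloring :: "nat \<Rightarrow> nat set \<Rightarrow> nat" where
  "path_coloring n S =
     (if S = {1} then n + 1 else if S \<in> path_edges then n + 2 else card S)"

lemma path_coloring_less: "card S \<le> n \<Longrightarrow> path_coloring n S < n + 3"
  by (simp add: path_coloring_def)

lemma path_coloring_eq_endpoint_iff:
  "card S \<le> n \<Longrightarrow> path_coloring n S = n + 1 \<longleftrightarrow> S = {1}"
  by (auto simp: path_coloring_def)

lemma path_coloring_eq_edge_iff:
  "card S \<le> n \<Longrightarrow> path_coloring n S = n + 2 \<longleftrightarrow> S \<in> path_edges"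
  by (auto simp: path_coloring_def dest: card_path_edge)

lemma path_coloring_eq_imp_card_eq:
  assumes "card S \<le> n" "card T \<le> n" "path_coloring n S = path_coloring n T"
  shows "card S = card T"
proof -
  have "S = {1} \<longleftrightarrow> T = {1}"
    using assms path_coloring_eq_endpoint_iff[of S n] path_coloring_eq_endpoint_iff[of T n] by simp
  moreover have "S \<in> path_edges \<longleftrightarrow> T \<in> path_edges"
    using assms path_coloring_eq_edge_iff[of S n] path_coloring_eq_edge_iff[of T n] by simp
  ultimately show ?thesis
    using assms(3) by (auto simp: path_coloring_def card_path_edge split: if_splits)
qed

lemma card_boolean_lattice_le: "S \<in> boolean_lattice_carrier n \<Longrightarrow> card S \<le> n"
  using card_mono[of "{1..n}" S] by (simp add: boolean_lattice_carrier_def)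

lemma proper_path_coloring:
  "proper_coloring (boolean_lattice_carrier n) (boolean_lattice_order n) (path_coloring n)"
proof (rule proper_coloring_if_color_determines_card)
  show "finite S" if "S \<in> boolean_lattice_carrier n" for S
    using that finite_subset[of S "{1..n}"] by (simp add: boolean_lattice_carrier_def)
  show "S \<subseteq> T" if "(S, T) \<in> boolean_lattice_order n" for S T
    using that by (simp add: boolean_lattice_order_def)
qed (intro path_coloring_eq_imp_card_eq card_boolean_lattice_le)

lemma path_coloring_preserving_permutation_fixes:
  assumes bij: "bij_betw \<sigma> {1..n} {1..n}"
    and color: "\<And>S. S \<subseteq> {1..n} \<Longrightarrow> path_coloring n (\<sigma> ` S) = path_coloring n S"
    and k: "k \<in> {1..n}"
  shows "\<sigma> k = k"
proof (rule path_automorphism_fixing_endpoint[OF _ _ _ _ k])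
  have card: "card S \<le> n" "card (\<sigma> ` S) \<le> n" if "S \<subseteq> {1..n}" for S
  proof -
    have "\<sigma> ` S \<subseteq> {1..n}"
      using bij_betwE[OF bij] that by blast
    then show "card S \<le> n" "card (\<sigma> ` S) \<le> n"
      using card_boolean_lattice_le that by (simp_all add: boolean_lattice_carrier_def)
  qed
  show "inj_on \<sigma> {1..n}"
    by (rule bij_betw_imp_inj_on[OF bij])
  show "1 \<le> \<sigma> i" if "i \<in> {1..n}" for i
    using bij_betwE[OF bij] that by auto
  have "\<sigma> ` {1} = {1}"
    using color[of "{1}"] card[of "{1}"] k path_coloring_eq_endpoint_iff[of "{1}" n]
      path_coloring_eq_endpoint_iff[of "\<sigma> ` {1}" n] by auto
  then show "\<sigma> 1 = 1"
    by simp
  show "{\<sigma> i, \<sigma> (Suc i)} \<in> path_edges" if "i \<in> {1..<n}" for i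
  proof -
    have sub: "{i, Suc i} \<subseteq> {1..n}"
      using that by auto
    have "{i, Suc i} \<in> path_edges"
      by (simp add: doubleton_in_path_edges_iff)
    then have "\<sigma> ` {i, Suc i} \<in> path_edges"
      using color[OF sub] card[OF sub] path_coloring_eq_edge_iff by metis
    then show ?thesis
      by simp
  qed
qed

lemma distinguishing_path_coloring:
  "distinguishing_coloring (boolean_lattice_carrier n) (boolean_lattice_order n) (path_coloring n)"
  unfolding distinguishing_coloring_def
proof (intro allI impI ballI, elim conjE)
  fix f S
  assume "poset_automorphism (boolean_lattice_carrier n) (boolean_lattice_order n) f"
    and color: "\<forall>S\<in>boolean_lattice_carrier n. path_coloring n (f S) = path_coloring n S"
    and "S \<in> boolean_lattice_carrier n"
  then interpret Pow_automorphism "{1..n}" f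
    by (intro boolean_lattice_automorphism_imp_Pow_automorphism)
  obtain \<sigma> where bij: "bij_betw \<sigma> {1..n} {1..n}"
    and image: "\<And>T. T \<subseteq> {1..n} \<Longrightarrow> f T = \<sigma> ` T"
    using induced_by_permutation by blast
  have S: "S \<subseteq> {1..n}"
    using \<open>S \<in> boolean_lattice_carrier n\<close> by (simp add: boolean_lattice_carrier_def)
  have "path_coloring n (\<sigma> ` T) = path_coloring n T" if "T \<subseteq> {1..n}" for T
    using bspec[OF color, of T] image[OF that] that by (simp add: boolean_lattice_carrier_def)
  then have "\<sigma> k = k" if "k \<in> S" for k
    using path_coloring_preserving_permutation_fixes[OF bij] S that by blast
  then show "f S = S"
    using image[OF S] by simp
qed

theorem theorem4p9:
  fixes n :: nat
  assumes "n \<ge> 1"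
  shows "distinguishing_chromatic_number (boolean_lattice_carrier n) (boolean_lattice_order n) \<le> n + 3"
proof (rule distinguishing_chromatic_number_le)
  show "path_coloring n ` boolean_lattice_carrier n \<subseteq> {..<n + 3}"
    using path_coloring_less card_boolean_lattice_le by auto
qed (rule proper_path_coloring distinguishing_path_coloring)+

end
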